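(* Let $k$ be a field of characteristic zero, let $A$ be a commutative unital associative $k$-algebra, and let $\phi:A\to k$ be a unital linear form, extended to a unital linear form on $\overline T(A)$ by $\phi(a_1a_2\cdots a_n):=\phi(a_1\cdot_A a_2\cdot_A\cdots\cdot_A a_n)$, where $\cdot_A$ is the product in $A$. Let $c:\overline T(A)\to k$ be the linear form with $c(\mathbf 1)=0$ solving the linear fixed point equation $$\phi=e+c\prec\phi .$$ For $a\in A$ put $c_n:=c(a^{\otimes n})$ for $n\ge1$ and $m_n:=\phi(a^{\otimes n})=\phi(a^n)$ for $n\ge0$. Then for all $n\ge1$ the (classical) moment-cumulant relation $$m_n=\sum_{j=0}^{n-1}\binom{n-1}{j}c_{j+1}\,m_{n-j-1}$$ holds; that is, the $c_n$ are the classical cumulants associated with the moments $m_n$.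
   Context: $\overline T(A):=\bigoplus_{n\ge0}A^{\otimes n}$ is the tensor algebra, with elements written as words $a_1\cdots a_n$ and empty word $\mathbf 1$ (so $\phi(\mathbf 1)=1$); $T(A):=\bigoplus_{n>0}A^{\otimes n}$; $a^{\otimes n}$ is the word $a\cdots a$ of length $n$ and $a^n$ the $n$-th power in $A$. For a word $a_1\cdots a_n$ and $J=\{j_1<\cdots<j_p\}\subseteq[n]=\{1,\dots,n\}$, $a_J:=a_{j_1}\cdots a_{j_p}$, $a_\emptyset:=\mathbf 1$. The left half-unshuffle coproduct is defined on $T(A)$ by $$\Delta_\prec(a_1\cdots a_n):=\sum_{1\in J\subseteq[n]}a_J\otimes a_{[n]-J}.$$ For a linear form $f$ on $\overline T(A)$ with $f(\mathbf 1)=0$ and a linear form $g$ on $\overline T(A)$, $f\prec g:=m_k\circ(f\otimes g)\circ\Delta_\prec$ on $T(A)$ and $(f\prec g)(\mathbf 1):=0$, where $m_k$ is the product of $k$. $e:\overline T(A)\to k$ is the identity on $A^{\otimes0}=k$ and zero on $A^{\otimes n}$, $n\ge1$. The classical cumulants $(c_n)_{n\ge1}$ attached to a moment sequence $(m_n)_{n\ge0}$ with $m_0=1$ are the scalars defined by $\sum_{n\ge1}c_n\frac{z^n}{n!}=\log\Big(\sum_{n\ge0}m_n\frac{z^n}{n!}\Big)$, equivalently by $m_n=c_n+\sum_{m=1}^{n-1}\binom{n-1}{m-1}c_m\,m_{n-m}$ for $n\ge1$. *)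

theory Defs
  imports Complex_Main "HOL-Library.Poly_Mapping"
    "HOL-Computational_Algebra.Formal_Power_Series"
begin

(* A commutative unital associative algebra over a field: the ring is the type 'a, the ground
   field is the type 'k, and scale is the scalar multiplication. *)
locale comm_algebra = vector_space scale
  for scale :: "'k::field \<Rightarrow> 'a::comm_ring_1 \<Rightarrow> 'a" +
  assumes scale_mult_left: "scale r (x * y) = scale r x * y"

definition fscale :: "'k::field \<Rightarrow> ('b \<Rightarrow>\<^sub>0 'k) \<Rightarrow> ('b \<Rightarrow>\<^sub>0 'k)" where
  "fscale r p = Poly_Mapping.map ((*) r) p"

lemma lookup_fscale: "Poly_Mapping.lookup (fscale r p) b = r * Poly_Mapping.lookup p b"
  unfolding fscale_def by transfer (auto simp: when_def)

global_interpretation free: vector_space "fscale :: 'k::field \<Rightarrow> ('b \<Rightarrow>\<^sub>0 'k) \<Rightarrow> ('b \<Rightarrow>\<^sub>0 'k)"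
  by unfold_locales
    (simp_all add: poly_mapping_eq_iff fun_eq_iff lookup_fscale lookup_add algebra_simps)

abbreviation gen :: "'b \<Rightarrow> ('b \<Rightarrow>\<^sub>0 'k::field)" where
  "gen b \<equiv> Poly_Mapping.single b 1"

(* The linear extension of a map h on the generators; s is the scaling of the target space. *)
definition lin_ext :: "('k::field \<Rightarrow> 'v \<Rightarrow> 'v::ab_group_add) \<Rightarrow> ('b \<Rightarrow> 'v) \<Rightarrow> ('b \<Rightarrow>\<^sub>0 'k) \<Rightarrow> 'v" where
  "lin_ext s h p = (\<Sum>b\<in>Poly_Mapping.keys p. s (Poly_Mapping.lookup p b) (h b))"

(* A slot is a map g sending a letter x to the generator that has x at a given place, the other
   letters being fixed. The relations say that generators depend linearly on each slot. *)
definition multilin_rels ::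
  "('k::field \<Rightarrow> 'a::ab_group_add \<Rightarrow> 'a) \<Rightarrow> ('a \<Rightarrow> 'b) set \<Rightarrow> ('b \<Rightarrow>\<^sub>0 'k) set" where
  "multilin_rels scale G =
     {gen (g (x + y)) - gen (g x) - gen (g y) | g x y. g \<in> G} \<union>
     {gen (g (scale r x)) - fscale r (gen (g x)) | g r x. g \<in> G}"

definition multilin_equiv ::
  "('k::field \<Rightarrow> 'a::ab_group_add \<Rightarrow> 'a) \<Rightarrow> ('a \<Rightarrow> 'b) set \<Rightarrow> (('b \<Rightarrow>\<^sub>0 'k) \<times> ('b \<Rightarrow>\<^sub>0 'k)) set" where
  "multilin_equiv scale G = {(p, q). p - q \<in> free.span (multilin_rels scale G)}"

definition word_slots :: "('a \<Rightarrow> 'a list) set" where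
  "word_slots = {\<lambda>x. u @ x # v | u v. True}"

definition word_pair_slots :: "('a \<Rightarrow> 'a list \<times> 'a list) set" where
  "word_pair_slots =
     {\<lambda>x. (u @ x # v, w) | u v w. True} \<union> {\<lambda>x. (w, u @ x # v) | u v w. True}"

(* The direct sum of all A^{\<otimes>n}, n \<ge> 0: generated by all words, subject to linearity in
   each letter. *)
definition tensor_algebra ::
  "('k::field \<Rightarrow> 'a::ab_group_add \<Rightarrow> 'a) \<Rightarrow> ('a list \<Rightarrow>\<^sub>0 'k) set set" where
  "tensor_algebra scale = UNIV // multilin_equiv scale word_slots"

definition tcls ::
  "('k::field \<Rightarrow> 'a::ab_group_add \<Rightarrow> 'a) \<Rightarrow> ('a list \<Rightarrow>\<^sub>0 'k) \<Rightarrow> ('a list \<Rightarrow>\<^sub>0 'k) set" where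
  "tcls scale p = multilin_equiv scale word_slots `` {p}"

abbreviation tword ::
  "('k::field \<Rightarrow> 'a::ab_group_add \<Rightarrow> 'a) \<Rightarrow> 'a list \<Rightarrow> ('a list \<Rightarrow>\<^sub>0 'k) set" where
  "tword scale w \<equiv> tcls scale (gen w)"

(* The class of p in the tensor product of the tensor algebra with itself. That space is the direct
   sum of all A^{\<otimes>p} \<otimes> A^{\<otimes>q}: generated by the pairs (u, v), standing for
   u \<otimes> v, of words, subject to linearity in each letter of u and of v. *)
definition tcls2 ::
  "('k::field \<Rightarrow> 'a::ab_group_add \<Rightarrow> 'a) \<Rightarrow> ('a list \<times> 'a list \<Rightarrow>\<^sub>0 'k)
    \<Rightarrow> ('a list \<times> 'a list \<Rightarrow>\<^sub>0 'k) set" where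
  "tcls2 scale p = multilin_equiv scale word_pair_slots `` {p}"

(* Only the values on tensor_algebra scale matter. *)
definition tensor_linear_form ::
  "('k::field \<Rightarrow> 'a::ab_group_add \<Rightarrow> 'a) \<Rightarrow> (('a list \<Rightarrow>\<^sub>0 'k) set \<Rightarrow> 'k) \<Rightarrow> bool" where
  "tensor_linear_form scale f \<longleftrightarrow>
     (\<forall>p q. f (tcls scale (p + q)) = f (tcls scale p) + f (tcls scale q)) \<and>
     (\<forall>r p. f (tcls scale (fscale r p)) = r * f (tcls scale p))"

(* The linear form on a quotient of a free space given by its values h on the generators; used
   only for h linear in each slot, where all representatives give the same value. *)
definition form_of :: "('b \<Rightarrow> 'k::field) \<Rightarrow> ('b \<Rightarrow>\<^sub>0 'k) set \<Rightarrow> 'k" where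
  "form_of h X = the_elem (lin_ext (*) h ` X)"

(* Positions are counted from 0, so the first letter has index 0. For the empty word the sum has
   no terms: the coproduct is extended by zero from T(A) to the whole tensor algebra, which gives
   the convention that the half-convolution product vanishes on the empty word. *)
definition half_unshuffle_word :: "'a list \<Rightarrow> ('a list \<times> 'a list \<Rightarrow>\<^sub>0 'k::field)" where
  "half_unshuffle_word w =
     (\<Sum>J | J \<subseteq> {..<length w} \<and> 0 \<in> J. gen (nths w J, nths w ({..<length w} - J)))"

definition half_unshuffle ::
  "('k::field \<Rightarrow> 'a::ab_group_add \<Rightarrow> 'a) \<Rightarrow> ('a list \<Rightarrow>\<^sub>0 'k) set
    \<Rightarrow> ('a list \<times> 'a list \<Rightarrow>\<^sub>0 'k) set" where
  "half_unshuffle scale X = (\<Union>p\<in>X. tcls2 scale (lin_ext fscale half_unshuffle_word p))"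

(* f \<otimes> g followed by the product of the ground field. *)
definition tensor_form ::
  "('k::field \<Rightarrow> 'a::ab_group_add \<Rightarrow> 'a) \<Rightarrow> (('a list \<Rightarrow>\<^sub>0 'k) set \<Rightarrow> 'k)
    \<Rightarrow> (('a list \<Rightarrow>\<^sub>0 'k) set \<Rightarrow> 'k) \<Rightarrow> ('a list \<times> 'a list \<Rightarrow>\<^sub>0 'k) set \<Rightarrow> 'k" where
  "tensor_form scale f g = form_of (\<lambda>(u, v). f (tword scale u) * g (tword scale v))"

definition half_conv ::
  "('k::field \<Rightarrow> 'a::ab_group_add \<Rightarrow> 'a) \<Rightarrow> (('a list \<Rightarrow>\<^sub>0 'k) set \<Rightarrow> 'k)
    \<Rightarrow> (('a list \<Rightarrow>\<^sub>0 'k) set \<Rightarrow> 'k) \<Rightarrow> ('a list \<Rightarrow>\<^sub>0 'k) set \<Rightarrow> 'k" where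
  "half_conv scale f g X = tensor_form scale f g (half_unshuffle scale X)"

definition counit_form :: "('a list \<Rightarrow>\<^sub>0 'k::field) set \<Rightarrow> 'k" where
  "counit_form = form_of (\<lambda>w. if w = [] then 1 else 0)"

definition extend_form :: "('a::comm_ring_1 \<Rightarrow> 'k::field) \<Rightarrow> ('a list \<Rightarrow>\<^sub>0 'k) set \<Rightarrow> 'k" where
  "extend_form \<phi> = form_of (\<lambda>w. \<phi> (prod_list w))"

(* fps_ln 1 is the series log (1 + X). *)
definition classical_cumulant :: "(nat \<Rightarrow> 'k::field_char_0) \<Rightarrow> nat \<Rightarrow> 'k" where
  "classical_cumulant m n =
     fact n * fps_nth (fps_ln 1 oo (Abs_fps (\<lambda>i. m i / fact i) - 1)) n"

end

theory Submission
  imports Defs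
begin

text \<open>
  A linear form on one of the quotient spaces at hand is the same thing as a function on words (or
  on pairs of words) that is linear in each slot; \<open>form_of_class\<close> says that it may then be evaluated
  on any representative. Splitting a word along a fixed set \<open>J\<close> of positions turns each slot of
  the word into a slot of the pair (\<open>unshuffle_slot\<close>), so the half-convolution of two slot-linear
  forms is computed on a word by the expected sum over all \<open>J\<close> that contain the first position
  (\<open>half_conv_word\<close>).

  On the word \<open>a\<^sup>n\<close> with all letters equal, the summand for \<open>J\<close> depends only on the size of \<open>J\<close>,
  and there are \<open>(n - 1) choose j\<close> sets of size \<open>j + 1\<close> that contain the first position. The
  fixed point equation \<open>\<phi> = e + c \<prec> \<phi>\<close> on \<open>a\<^sup>n\<close>, where \<open>e\<close> vanishes, therefore is
  the moment-cumulant recursion.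

  For the exponential generating functions \<open>M\<close> of the moments and \<open>C\<close> of the cumulants, that
  recursion reads \<open>M' = C' M\<close>. As \<open>M\<close> has constant term 1 and \<open>C\<close> has constant term 0, it follows
  that \<open>C = log M\<close> (\<open>fps_log_unique\<close>).
\<close>

section \<open>Forms on spaces presented by multilinear relations\<close>

definition slot_linear ::
  "('k::field \<Rightarrow> 'a::ab_group_add \<Rightarrow> 'a) \<Rightarrow> ('a \<Rightarrow> 'b) set \<Rightarrow> ('b \<Rightarrow> 'k) \<Rightarrow> bool" where
  "slot_linear scale G h \<longleftrightarrow>
     (\<forall>g\<in>G. \<forall>x y. h (g (x + y)) = h (g x) + h (g y)) \<and>
     (\<forall>g\<in>G. \<forall>r x. h (g (scale r x)) = r * h (g x))"

lemma lin_ext_eq_sum: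
  fixes h :: "'b \<Rightarrow> 'k::field"
  assumes "finite S" "Poly_Mapping.keys p \<subseteq> S"
  shows "lin_ext (*) h p = (\<Sum>b\<in>S. Poly_Mapping.lookup p b * h b)"
  unfolding lin_ext_def using assms
  by (intro sum.mono_neutral_left) (auto simp: in_keys_iff)

lemma lin_ext_gen: "lin_ext (*) h (gen b) = (h b :: 'k::field)"
  by (simp add: lin_ext_def)

lemma linear_lin_ext:
  "Vector_Spaces.linear fscale (*) (lin_ext (*) (h :: 'b \<Rightarrow> 'k::field))"
proof -
  have add: "lin_ext (*) h (p + q) = lin_ext (*) h p + lin_ext (*) h q" for p q :: "'b \<Rightarrow>\<^sub>0 'k"
  proof -
    let ?S = "Poly_Mapping.keys p \<union> Poly_Mapping.keys q"
    have "Poly_Mapping.keys (p + q) \<subseteq> ?S"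
      by (rule Poly_Mapping.keys_add)
    then show ?thesis
      by (simp add: lin_ext_eq_sum[of ?S] lookup_add distrib_right sum.distrib)
  qed
  have scl: "lin_ext (*) h (fscale r p) = r * lin_ext (*) h p" for r and p :: "'b \<Rightarrow>\<^sub>0 'k"
  proof -
    have "Poly_Mapping.keys (fscale r p) \<subseteq> Poly_Mapping.keys p"
      by (auto simp: in_keys_iff lookup_fscale)
    then show ?thesis
      by (simp add: lin_ext_eq_sum[of "Poly_Mapping.keys p"] lookup_fscale sum_distrib_left
          mult.assoc)
  qed
  have "vector_space ((*) :: 'k \<Rightarrow> 'k \<Rightarrow> 'k)"
    by unfold_locales (simp_all add: algebra_simps)
  then show ?thesis
    using add scl free.vector_space_axioms by (simp add: Vector_Spaces.linear_iff)
qed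

lemma lin_ext_comp:
  fixes h :: "'c \<Rightarrow> 'k::field"
  shows "lin_ext (*) h (lin_ext fscale d p) = lin_ext (*) (\<lambda>b. lin_ext (*) h (d b)) p"
proof -
  interpret Vector_Spaces.linear fscale "(*)" "lin_ext (*) h"
    by (rule linear_lin_ext)
  show ?thesis
    unfolding lin_ext_def[of fscale] lin_ext_def[of _ "\<lambda>b. lin_ext (*) h (d b)"]
      sum scale ..
qed

text \<open>
  Slot-linearity of \<open>h\<close> says exactly that its linear extension kills the relations, hence their
  span.
\<close>

lemma lin_ext_equiv:
  assumes h: "slot_linear scale G h" and pq: "(p, q) \<in> multilin_equiv scale G"
  shows "lin_ext (*) h p = lin_ext (*) h q"
proof -
  interpret Vector_Spaces.linear fscale "(*)" "lin_ext (*) h"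
    by (rule linear_lin_ext)
  have "lin_ext (*) h (p - q) = 0"
  proof (rule eq_0_on_span)
    show "p - q \<in> free.span (multilin_rels scale G)"
      using pq by (simp add: multilin_equiv_def)
    show "lin_ext (*) h x = 0" if "x \<in> multilin_rels scale G" for x
      using that h unfolding multilin_rels_def slot_linear_def
      by (auto simp: diff scale lin_ext_gen)
  qed
  then show ?thesis
    by (simp add: diff)
qed

lemma equiv_multilin_equiv: "equiv UNIV (multilin_equiv scale G)"
proof (rule equivI)
  show "refl (multilin_equiv scale G)"
    by (auto simp: refl_on_def multilin_equiv_def free.span_zero)
  show "sym (multilin_equiv scale G)"
    unfolding sym_def multilin_equiv_def using free.span_neg by fastforce
  show "trans (multilin_equiv scale G)"
    unfolding trans_def multilin_equiv_def using free.span_add by fastforce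
qed simp

lemma form_of_class:
  assumes "slot_linear scale G h"
  shows "form_of h (multilin_equiv scale G `` {p}) = lin_ext (*) h p"
proof -
  have "p \<in> multilin_equiv scale G `` {p}"
    using equiv_multilin_equiv[of scale G] by (auto simp: equiv_def refl_on_def)
  moreover have "lin_ext (*) h q = lin_ext (*) h p" if "q \<in> multilin_equiv scale G `` {p}" for q
    using lin_ext_equiv[OF assms, of p q] that by simp
  ultimately have "lin_ext (*) h ` (multilin_equiv scale G `` {p}) = {lin_ext (*) h p}"
    by (metis (no_types, lifting) empty_iff image_cong image_constant_conv)
  then show ?thesis
    by (simp add: form_of_def)
qed

lemma tcls_eqI:
  assumes "p - q \<in> multilin_rels scale word_slots"
  shows "tcls scale p = tcls scale q"
  unfolding tcls_def using assms
  by (intro equiv_class_eq[OF equiv_multilin_equiv]) (simp add: multilin_equiv_def free.span_base)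

lemma slot_linear_tensor_form:
  assumes "tensor_linear_form scale f"
  shows "slot_linear scale word_slots (\<lambda>w. f (tword scale w))"
proof -
  have "tword scale (g (x + y)) = tcls scale (gen (g x) + gen (g y))"
    if "g \<in> word_slots" for g x y
    using that by (intro tcls_eqI) (auto simp: multilin_rels_def diff_diff_eq)
  moreover have "tword scale (g (scale r x)) = tcls scale (fscale r (gen (g x)))"
    if "g \<in> word_slots" for g r x
    using that by (intro tcls_eqI) (unfold multilin_rels_def, blast)
  ultimately show ?thesis
    using assms by (simp add: slot_linear_def tensor_linear_form_def)
qed

lemma slot_linear_prod_list:
  fixes \<phi> :: "'a::comm_ring_1 \<Rightarrow> 'k::field"
  assumes "comm_algebra scale" and "Vector_Spaces.linear scale (*) \<phi>"
  shows "slot_linear scale word_slots (\<lambda>w. \<phi> (prod_list w))"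
proof -
  interpret comm_algebra scale by fact
  interpret \<phi>: Vector_Spaces.linear scale "(*)" \<phi> by fact
  have "\<phi> (u * ((x + y) * v)) = \<phi> (u * (x * v)) + \<phi> (u * (y * v))" for u v x y
    by (simp add: distrib_left distrib_right \<phi>.add)
  moreover have "\<phi> (u * (scale r x * v)) = r * \<phi> (u * (x * v))" for u v r x
  proof -
    have "u * (scale r x * v) = scale r (u * (x * v))"
      by (metis scale_mult_left mult.commute)
    then show ?thesis
      by (simp add: \<phi>.scale)
  qed
  ultimately show ?thesis
    by (auto simp: slot_linear_def word_slots_def)
qed

lemma slot_linear_product:
  fixes scale :: "'k::field \<Rightarrow> 'a::ab_group_add \<Rightarrow> 'a"
  assumes "slot_linear scale word_slots h1" "slot_linear scale word_slots h2"
  shows "slot_linear scale word_pair_slots (\<lambda>(u, v). h1 u * h2 v)"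
proof -
  have slot: "(\<lambda>x. u @ x # v) \<in> word_slots" for u v :: "'a list"
    by (auto simp: word_slots_def)
  note lin1 = assms(1)[unfolded slot_linear_def, THEN conjunct1, rule_format, OF slot]
    assms(1)[unfolded slot_linear_def, THEN conjunct2, rule_format, OF slot]
  note lin2 = assms(2)[unfolded slot_linear_def, THEN conjunct1, rule_format, OF slot]
    assms(2)[unfolded slot_linear_def, THEN conjunct2, rule_format, OF slot]
  show ?thesis
    unfolding slot_linear_def word_pair_slots_def
    by (auto simp: lin1 lin2 algebra_simps)
qed

section \<open>Half-convolution on words\<close>

text \<open>
  The varying letter goes to the left factor if its position is in \<open>J\<close>, and to the right factor
  otherwise. The other letters are distributed independently of it.
\<close>

lemma unshuffle_slot:
  assumes "g \<in> word_slots"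
  shows "(\<lambda>x. (nths (g x) J, nths (g x) ({..<length (g x)} - J))) \<in> word_pair_slots"
proof -
  obtain u v where g: "g = (\<lambda>x. u @ x # v)"
    using assms by (auto simp: word_slots_def)
  let ?K = "{..<length u + Suc (length v)} - J"
  show ?thesis
  proof (cases "length u \<in> J")
    case True
    let ?u = "nths u J" and ?v = "nths v {j. Suc j + length u \<in> J}"
      and ?w = "nths u ?K @ nths v {j. Suc j + length u \<in> ?K}"
    have "(\<lambda>x. (nths (g x) J, nths (g x) ({..<length (g x)} - J)))
        = (\<lambda>x. (?u @ x # ?v, ?w))"
      using True by (simp add: g nths_append nths_Cons)
    then show ?thesis
      unfolding word_pair_slots_def by blast
  next
    case False
    let ?w = "nths u J @ nths v {j. Suc j + length u \<in> J}"
      and ?u = "nths u ?K" and ?v = "nths v {j. Suc j + length u \<in> ?K}"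
    have "(\<lambda>x. (nths (g x) J, nths (g x) ({..<length (g x)} - J)))
        = (\<lambda>x. (?w, ?u @ x # ?v))"
      using False by (simp add: g nths_append nths_Cons)
    then show ?thesis
      unfolding word_pair_slots_def by blast
  qed
qed

lemma lin_ext_half_unshuffle_word:
  fixes h :: "'a list \<times> 'a list \<Rightarrow> 'k::field"
  shows "lin_ext (*) h (half_unshuffle_word w) =
    (\<Sum>J | J \<subseteq> {..<length w} \<and> 0 \<in> J. h (nths w J, nths w ({..<length w} - J)))"
proof -
  interpret Vector_Spaces.linear fscale "(*)" "lin_ext (*) h"
    by (rule linear_lin_ext)
  show ?thesis
    by (simp add: half_unshuffle_word_def sum lin_ext_gen)
qed

lemma slot_linear_half_unshuffle:
  fixes h :: "'a::ab_group_add list \<times> 'a list \<Rightarrow> 'k::field"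
  assumes "slot_linear scale word_pair_slots h"
  shows "slot_linear scale word_slots (\<lambda>w. lin_ext (*) h (half_unshuffle_word w))"
    (is "slot_linear _ _ ?H")
proof -
  have "(\<forall>x y. ?H (g (x + y)) = ?H (g x) + ?H (g y)) \<and>
      (\<forall>r x. ?H (g (scale r x)) = r * ?H (g x))"
    if g: "g \<in> word_slots" for g
  proof -
    \<comment> \<open>The sets \<open>J\<close> range over the same index set for every choice of the varying letter.\<close>
    obtain n where len: "\<And>x. length (g x) = n"
      using g by (auto simp: word_slots_def)
    have slot: "(\<lambda>x. (nths (g x) J, nths (g x) ({..<n} - J))) \<in> word_pair_slots" for J
      using unshuffle_slot[OF g, of J] by (simp add: len)
    note lin = assms[unfolded slot_linear_def, THEN conjunct1, rule_format, OF slot]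
      assms[unfolded slot_linear_def, THEN conjunct2, rule_format, OF slot]
    show ?thesis
      by (simp add: lin_ext_half_unshuffle_word len lin sum.distrib sum_distrib_left)
  qed
  then show ?thesis
    by (simp add: slot_linear_def)
qed

text \<open>
  The coproduct of a class is a union over all its representatives. Evaluating the form on any of
  them gives the same scalar, because the composite with the coproduct is again slot-linear.
\<close>

lemma half_conv_word:
  fixes scale :: "'k::field \<Rightarrow> 'a::ab_group_add \<Rightarrow> 'a"
  assumes f: "slot_linear scale word_slots (\<lambda>w. f (tword scale w))"
    and g: "slot_linear scale word_slots (\<lambda>w. g (tword scale w))"
  shows "half_conv scale f g (tword scale w) =
    (\<Sum>J | J \<subseteq> {..<length w} \<and> 0 \<in> J.
      f (tword scale (nths w J)) * g (tword scale (nths w ({..<length w} - J))))"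
proof -
  let ?h = "\<lambda>(u, v). f (tword scale u) * g (tword scale v)"
  let ?d = "half_unshuffle_word :: 'a list \<Rightarrow> ('a list \<times> 'a list \<Rightarrow>\<^sub>0 'k)"
  have h: "slot_linear scale word_pair_slots ?h"
    using slot_linear_product[OF f g] .
  have const: "lin_ext (*) ?h q = lin_ext (*) ?h (?d w)"
    if q: "q \<in> half_unshuffle scale (tword scale w)" for q
  proof -
    obtain p where p: "(gen w, p) \<in> multilin_equiv scale word_slots"
      and pq: "(lin_ext fscale ?d p, q) \<in> multilin_equiv scale word_pair_slots"
      using q by (auto simp: half_unshuffle_def tcls_def tcls2_def)
    have "lin_ext (*) ?h q = lin_ext (*) (\<lambda>w. lin_ext (*) ?h (?d w)) p"
      using lin_ext_equiv[OF h pq] by (simp add: lin_ext_comp)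
    also have "\<dots> = lin_ext (*) (\<lambda>w. lin_ext (*) ?h (?d w)) (gen w)"
      using lin_ext_equiv[OF slot_linear_half_unshuffle[OF h] p] by simp
    finally show ?thesis
      by (simp add: lin_ext_gen)
  qed
  have "gen w \<in> tword scale w"
    "lin_ext fscale ?d (gen w) \<in> tcls2 scale (lin_ext fscale ?d (gen w))"
    using equiv_multilin_equiv by (auto simp: tcls_def tcls2_def equiv_def refl_on_def)
  then have "half_unshuffle scale (tword scale w) \<noteq> {}"
    unfolding half_unshuffle_def by blast
  then have "lin_ext (*) ?h ` half_unshuffle scale (tword scale w) = {lin_ext (*) ?h (?d w)}"
    by (simp add: const image_constant_conv cong: image_cong)
  then show ?thesis
    by (simp add: half_conv_def tensor_form_def form_of_def lin_ext_half_unshuffle_word)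
qed

section \<open>Words with all letters equal\<close>

lemma nths_replicate: "nths (replicate n a) J = replicate (card (J \<inter> {..<n})) a"
proof -
  have "set (nths (replicate n a) J) \<subseteq> {a}"
    using set_nths_subset[of "replicate n a" J] by auto
  moreover have "length (nths (replicate n a) J) = card (J \<inter> {..<n})"
    by (auto simp: length_nths intro: arg_cong[where f = card])
  ultimately show ?thesis
    by (simp add: replicate_eqI subset_iff)
qed

lemma sum_subsets_card:
  fixes F :: "nat \<Rightarrow> 'k::comm_semiring_1"
  assumes "finite A"
  shows "(\<Sum>K | K \<subseteq> A. F (card K)) = (\<Sum>j = 0..card A. of_nat (card A choose j) * F j)"
proof -
  have "(\<Sum>K | K \<subseteq> A. F (card K)) =
      (\<Sum>j = 0..card A. \<Sum>K | K \<in> {K. K \<subseteq> A} \<and> card K = j. F (card K))"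
    using assms by (intro sum.group[symmetric]) (auto intro: card_mono)
  also have "\<dots> = (\<Sum>j = 0..card A. of_nat (card A choose j) * F j)"
    by (intro sum.cong refl) (simp add: n_subsets[OF assms])
  finally show ?thesis .
qed

text \<open>
  Removing the first position from \<open>J\<close> leaves an arbitrary subset of the other \<open>n - 1\<close>
  positions. This is where the index shift of the recursion comes from.
\<close>

lemma sum_subsets_with_first:
  fixes F :: "nat \<Rightarrow> 'k::comm_semiring_1"
  assumes "n \<ge> 1"
  shows "(\<Sum>J | J \<subseteq> {..<n} \<and> 0 \<in> J. F (card J)) =
    (\<Sum>j = 0..n - 1. of_nat ((n - 1) choose j) * F (j + 1))"
proof -
  have "(\<Sum>J | J \<subseteq> {..<n} \<and> 0 \<in> J. F (card J)) = (\<Sum>K | K \<subseteq> {1..<n}. F (card K + 1))"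
  proof (rule sum.reindex_bij_witness[of _ "insert 0" "\<lambda>J. J - {0}"])
    fix J assume J: "J \<in> {J. J \<subseteq> {..<n} \<and> 0 \<in> J}"
    then have "finite J"
      by (auto intro: finite_subset)
    then show "F (card (J - {0}) + 1) = F (card J)"
      using J card_Suc_Diff1[of J 0] by simp
    show "J - {0} \<in> {K. K \<subseteq> {1..<n}}"
      using J by (auto simp: Suc_le_eq)
  qed (use assms in \<open>auto simp: subset_iff\<close>)
  then show ?thesis
    using sum_subsets_card[of "{1..<n}" "\<lambda>i. F (i + 1)"] by simp
qed

lemma half_conv_replicate:
  assumes f: "slot_linear scale word_slots (\<lambda>w. f (tword scale w))"
    and g: "slot_linear scale word_slots (\<lambda>w. g (tword scale w))"
    and "n \<ge> 1"
  shows "half_conv scale f g (tword scale (replicate n a)) =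
    (\<Sum>j = 0..n - 1. of_nat ((n - 1) choose j) *
      (f (tword scale (replicate (j + 1) a)) * g (tword scale (replicate (n - j - 1) a))))"
proof -
  have "half_conv scale f g (tword scale (replicate n a)) =
      (\<Sum>J | J \<subseteq> {..<n} \<and> 0 \<in> J.
        f (tword scale (replicate (card J) a)) * g (tword scale (replicate (n - card J) a)))"
  proof -
    have "card (J \<inter> {..<n}) = card J" "card (({..<n} - J) \<inter> {..<n}) = n - card J"
      if "J \<subseteq> {..<n}" for J
    proof -
      have "finite J"
        using that by (auto intro: finite_subset)
      then show "card (({..<n} - J) \<inter> {..<n}) = n - card J"
        using that by (simp add: card_Diff_subset Int_absorb2)
      show "card (J \<inter> {..<n}) = card J"
        using that by (simp add: Int_absorb2)
    qed
    then show ?thesis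
      by (auto simp: half_conv_word[OF f g] nths_replicate intro!: sum.cong)
  qed
  then show ?thesis
    using \<open>n \<ge> 1\<close> by (simp add: sum_subsets_with_first[where F = "\<lambda>i.
      f (tword scale (replicate i a)) * g (tword scale (replicate (n - i) a))"])
qed

section \<open>The recursion in terms of exponential generating functions\<close>

text \<open>
  Both sides have the logarithmic derivative of \<open>M\<close> as derivative. In characteristic zero a
  power series is determined by its derivative and its constant term.
\<close>

lemma fps_log_unique:
  fixes M C :: "'k::field_char_0 fps"
  assumes M0: "fps_nth M 0 = 1" and C0: "fps_nth C 0 = 0"
    and deriv: "fps_deriv M = fps_deriv C * M"
  shows "C = fps_ln 1 oo (M - 1)"
proof -
  have z: "fps_nth (M - 1) 0 = 0"
    using M0 by simp
  have "fps_deriv (fps_ln 1 oo (M - 1)) = inverse M * fps_deriv M"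
    using z by (simp add: fps_compose_deriv fps_ln_deriv fps_inverse_compose
        fps_compose_add_distrib)
  also have "\<dots> = fps_deriv C * (inverse M * M)"
    by (simp add: deriv mult_ac)
  also have "\<dots> = fps_deriv C"
    using M0 by (simp add: inverse_mult_eq_1)
  finally show ?thesis
    using C0 by (simp add: fps_deriv_eq_iff)
qed

lemma recursion_imp_classical_cumulant:
  fixes \<kappa> m :: "nat \<Rightarrow> 'k::field_char_0"
  assumes m0: "m 0 = 1"
    and rec: "\<And>n. n \<ge> 1 \<Longrightarrow>
      m n = (\<Sum>j = 0..n - 1. of_nat ((n - 1) choose j) * \<kappa> (j + 1) * m (n - j - 1))"
    and "n \<ge> 1"
  shows "\<kappa> n = classical_cumulant m n"
proof -
  define M where "M = Abs_fps (\<lambda>i. m i / fact i)"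
  define C where "C = Abs_fps (\<lambda>i. if i = 0 then 0 else \<kappa> i / fact i)"
  have "fps_deriv M = fps_deriv C * M"
  proof (rule fps_ext)
    fix i
    have fact_Suc_div: "of_nat (Suc j) * (x / fact (Suc j)) = x / fact j" for j and x :: 'k
      by (simp del: of_nat_Suc)
    have "fps_nth (fps_deriv M) i = m (Suc i) / fact i"
      using fact_Suc_div[of i "m (Suc i)"] by (simp add: M_def del: of_nat_Suc fact_Suc)
    also have "\<dots> = (\<Sum>j = 0..i. of_nat (i choose j) * \<kappa> (j + 1) * m (i - j) / fact i)"
      using rec[of "Suc i"] by (simp add: sum_divide_distrib)
    also have "\<dots> = (\<Sum>j = 0..i. \<kappa> (j + 1) / fact j * (m (i - j) / fact (i - j)))"
      by (intro sum.cong refl) (simp add: binomial_fact field_simps)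
    also have "\<dots> = fps_nth (fps_deriv C * M) i"
      using fact_Suc_div by (simp add: fps_mult_nth C_def M_def del: of_nat_Suc fact_Suc)
    finally show "fps_nth (fps_deriv M) i = fps_nth (fps_deriv C * M) i" .
  qed
  then have log: "C = fps_ln 1 oo (M - 1)"
    by (intro fps_log_unique) (simp_all add: M_def C_def m0)
  then have "fps_nth (fps_ln 1 oo (M - 1)) n = \<kappa> n / fact n"
    using \<open>n \<ge> 1\<close> by (simp add: C_def flip: log)
  then show ?thesis
    by (simp add: classical_cumulant_def M_def)
qed

theorem mainTheorem6:
  fixes scale :: "'k::field_char_0 \<Rightarrow> 'a::comm_ring_1 \<Rightarrow> 'a"
    and \<phi> :: "'a \<Rightarrow> 'k"
    and c :: "('a list \<Rightarrow>\<^sub>0 'k) set \<Rightarrow> 'k"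
    and a :: 'a
    and \<kappa> m :: "nat \<Rightarrow> 'k"
  assumes "comm_algebra scale"
    and "Vector_Spaces.linear scale (*) \<phi>"
    and "\<phi> 1 = 1"
    and "tensor_linear_form scale c"
    and "c (tword scale []) = 0"
    and "\<forall>X\<in>tensor_algebra scale.
           extend_form \<phi> X = counit_form X + half_conv scale c (extend_form \<phi>) X"
    and "\<forall>n\<ge>1. \<kappa> n = c (tword scale (replicate n a))"
    and "\<forall>n. m n = extend_form \<phi> (tword scale (replicate n a))"
  shows "(\<forall>n. m n = \<phi> (a ^ n)) \<and>
         (\<forall>n\<ge>1. m n = (\<Sum>j = 0..n - 1. of_nat ((n - 1) choose j) * \<kappa> (j + 1) * m (n - j - 1))) \<and>
         (\<forall>n\<ge>1. \<kappa> n = classical_cumulant m n)"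
proof -
  note alg = assms(1) and lin = assms(2) and unit = assms(3) and c_lin = assms(4)
    and fixpoint = assms(6) and kappa = assms(7) and moments = assms(8)
  have \<phi>_slot: "slot_linear scale word_slots (\<lambda>w. \<phi> (prod_list w))"
    by (rule slot_linear_prod_list[OF alg lin])
  have ext: "extend_form \<phi> (tword scale w) = \<phi> (prod_list w)" for w
    by (simp add: extend_form_def tcls_def form_of_class[OF \<phi>_slot] lin_ext_gen)
  have counit_slot: "slot_linear scale word_slots (\<lambda>w. if w = [] then 1 else 0)"
    by (auto simp: slot_linear_def word_slots_def)
  have counit: "counit_form (tword scale w) = (if w = [] then 1 else 0 :: 'k)" for w
    by (simp add: counit_form_def tcls_def form_of_class[OF counit_slot] lin_ext_gen)
  have m: "m n = \<phi> (a ^ n)" for n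
    by (simp add: moments ext)
  have rec: "m n = (\<Sum>j = 0..n - 1. of_nat ((n - 1) choose j) * \<kappa> (j + 1) * m (n - j - 1))"
    if n: "n \<ge> 1" for n
  proof -
    have "tword scale (replicate n a) \<in> tensor_algebra scale"
      by (simp add: tcls_def tensor_algebra_def quotientI)
    then have "m n = half_conv scale c (extend_form \<phi>) (tword scale (replicate n a))"
      using fixpoint n by (simp add: moments counit)
    also have "\<dots> = (\<Sum>j = 0..n - 1. of_nat ((n - 1) choose j) *
        (c (tword scale (replicate (j + 1) a)) *
          extend_form \<phi> (tword scale (replicate (n - j - 1) a))))"
      using \<phi>_slot n
      by (intro half_conv_replicate slot_linear_tensor_form[OF c_lin]) (simp_all add: ext)
    also have "\<dots> = (\<Sum>j = 0..n - 1. of_nat ((n - 1) choose j) * \<kappa> (j + 1) * m (n - j - 1))"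
      using kappa by (intro sum.cong refl) (simp only: moments le_add2 mult.assoc)
    finally show ?thesis .
  qed
  moreover have "\<kappa> n = classical_cumulant m n" if "n \<ge> 1" for n
    using m[of 0] unit rec that by (intro recursion_imp_classical_cumulant) simp_all
  ultimately show ?thesis
    using m by blast
qed

end
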